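(* Let $r$ be a prime and $q$ a prime power with $q \equiv 1 \pmod r$. Let $f(x)\in \mathbb{F}_q[x]$ be a unicritical polynomial of degree $r$ with critical point $\gamma$ and leading coefficient $a$. Then $f$ is dynamically irreducible over $\mathbb{F}_q$ if and only if the set $$\left\lbrace -\frac{f(\gamma)}{a}\right\rbrace \cup \left\lbrace \frac{f^n(\gamma)}{a}: n\in \mathbb{Z},\ n>1\right\rbrace$$ contains no $r$-th powers in $\mathbb{F}_q$ (that is, no element of the form $y^r$ with $y\in\mathbb{F}_q$).
   Context: $\mathbb{F}_q$ denotes the finite field with $q$ elements. For a polynomial $f$, $f^n$ denotes the $n$-fold composition $f\circ f\circ\cdots\circ f$. A polynomial $f\in K[x]$ of degree at least $2$ over a field $K$ is dynamically irreducible over $K$ if $f^n$ is irreducible over $K$ for all positive integers $n$. A polynomial is unicritical if it has a single affine critical point $\gamma$; here this is taken to mean that $f(x)=a(x-\gamma)^r+e$ for some $a,\gamma,e\in\mathbb{F}_q$ with $a\neq 0$, where $r=\deg f$; equivalently $f(x+\gamma)-\gamma=ax^r+c$ with $c=e-\gamma$. *)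

theory Defs
  imports
    "HOL-Library.Cardinality"
    "HOL-Computational_Algebra.Computational_Algebra"
    "HOL-Number_Theory.Cong"
    "HOL-Number_Theory.Prime_Powers"
begin

definition poly_iterate :: "'a::comm_semiring_1 poly \<Rightarrow> nat \<Rightarrow> 'a poly" where
  "poly_iterate f n = ((\<lambda>g. f \<circ>\<^sub>p g) ^^ n) [:0, 1:]"

definition dynamically_irreducible :: "'a::field poly \<Rightarrow> bool" where
  "dynamically_irreducible f \<longleftrightarrow>
     degree f \<ge> 2 \<and> (\<forall>n>0. irreducible (poly_iterate f n))"

(* f = a (x - c)^r + e with r = deg f. The bound on the degree excludes constant and linear
   polynomials, which have this shape for every c although no c is their only critical point. *)
definition unicritical_at :: "'a::field poly \<Rightarrow> 'a \<Rightarrow> bool" where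
  "unicritical_at f c \<longleftrightarrow>
     degree f \<ge> 2 \<and>
     (\<exists>a e. a \<noteq> 0 \<and> f = smult a ([:- c, 1:] ^ degree f) + [:e:])"

end

theory Submission
  imports "HOL-Algebra.Algebraic_Closure_Type" "HOL-Number_Theory.Residues" Defs
begin

text \<open>
  Everything happens in an algebraic closure of \<open>F\<close>, the field with \<open>q\<close> elements, where
  \<open>frob j x = x ^ q ^ j\<close>. A polynomial of degree \<open>n > 0\<close> over \<open>F\<close> is irreducible iff the
  Frobenius orbit of one of its roots has exactly \<open>n\<close> elements.

  Let \<open>g\<close> be irreducible of degree \<open>m\<close> with root \<open>b\<close>, and \<open>f = a (x - c) ^ r + e\<close>. Then
  \<open>t + c\<close> is a root of \<open>g \<circ> f\<close> whenever \<open>t ^ r = (b - e) / a\<close>. Let \<open>N\<close> be the norm of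
  \<open>t ^ r\<close>, that is, the product of its conjugates. As \<open>r\<close> divides \<open>q - 1\<close>, we get
  \<open>frob m t = z t\<close> with \<open>z = N ^ ((q - 1) / r)\<close>, an \<open>r\<close>-th root of unity in \<open>F\<close>. Hence the orbit
  of \<open>t\<close> has the full size \<open>m r\<close> iff \<open>z \<noteq> 1\<close>, i.e. iff \<open>N\<close> is not an \<open>r\<close>-th power in \<open>F\<close>. Writing
  \<open>N\<close> as \<open>(-1) ^ m g(e) / (lc(g) a ^ m)\<close> and taking for \<open>g\<close> the iterates of \<open>f\<close> yields the
  criterion: up to \<open>r\<close>-th powers, \<open>N\<close> is \<open>- f(c) / a\<close> for the identity and \<open>f\<^sup>n\<^sup>+\<^sup>1(c) / a\<close> for \<open>f\<^sup>n\<close>.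
\<close>

section \<open>Evaluating polynomials in the algebraic closure\<close>

lemma poly_map_poly_hom:
  assumes "f 0 = 0" "\<And>x y. f (x + y) = f x + f y" "\<And>x y. f (x * y) = f x * f y"
  shows "poly (map_poly f p) (f x) = f (poly p x)"
  by (induction p) (simp_all add: map_poly_pCons assms)

abbreviation eval_ac :: "'a::field poly \<Rightarrow> 'a alg_closure \<Rightarrow> 'a alg_closure" where
  "eval_ac p \<equiv> poly (map_poly to_ac p)"

lemma eval_ac_to_ac: "eval_ac p (to_ac x) = to_ac (poly p x)"
  by (rule poly_map_poly_hom) simp_all

lemma eval_ac_add: "eval_ac (p + q) x = eval_ac p x + eval_ac q x"
proof -
  have "map_poly to_ac (p + q) = map_poly to_ac p + map_poly to_ac q"
    by (intro poly_eqI) (simp add: coeff_map_poly)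
  thus ?thesis by simp
qed

lemma eval_ac_mult: "eval_ac (p * q) x = eval_ac p x * eval_ac q x"
proof -
  have "map_poly to_ac (p * q) = map_poly to_ac p * map_poly to_ac q"
    by (intro poly_eqI) (simp add: coeff_map_poly coeff_mult to_ac_sum)
  thus ?thesis by simp
qed

lemma eval_ac_pCons: "eval_ac (pCons c p) x = to_ac c + x * eval_ac p x"
  by (simp add: map_poly_pCons)

lemma eval_ac_power: "eval_ac (p ^ n) x = eval_ac p x ^ n"
  by (induction n) (simp_all add: eval_ac_mult)

lemma eval_ac_smult: "eval_ac (smult c p) x = to_ac c * eval_ac p x"
  by (simp add: map_poly_smult)

lemma eval_ac_pcompose: "eval_ac (p \<circ>\<^sub>p q) x = eval_ac p (eval_ac q x)"
  by (induction p) (simp_all add: pcompose_pCons eval_ac_add eval_ac_mult eval_ac_pCons)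

lemma degree_map_poly_to_ac: "degree (map_poly to_ac p) = degree p"
  by (simp add: degree_map_poly)

lemma map_poly_to_ac_eq_0_iff: "map_poly to_ac p = 0 \<longleftrightarrow> p = 0"
  by (simp add: map_poly_eq_0_iff)

section \<open>The base field as the fixed field of Frobenius\<close>

lemma power_CARD_eq_self:
  fixes x :: "'a::{finite,field}"
  shows "x ^ CARD('a) = x"
proof (cases "x = 0")
  case False
  \<comment> \<open>Multiplication by \<open>x\<close> permutes the nonzero elements.\<close>
  have "\<Prod>(UNIV - {0}) = (\<Prod>y\<in>UNIV - {0}. x * y)"
    by (rule prod.reindex_bij_witness[of _ "\<lambda>y. x * y" "\<lambda>y. y / x"]) (use False in auto)
  also have "\<dots> = x ^ (CARD('a) - 1) * \<Prod>(UNIV - {0})"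
    by (simp add: prod.distrib)
  finally have "x ^ (CARD('a) - 1) = 1"
    by simp
  moreover have "CARD('a) = Suc (CARD('a) - 1)"
    using zero_less_card_finite[where 'a = 'a] by simp
  ultimately show ?thesis
    by (metis mult.right_neutral power_Suc)
qed (simp add: power_0_left)

text \<open>X^q - X has at most q roots, and the q images of base field elements already exhaust
  them.\<close>

lemma to_ac_range_iff:
  fixes x :: "'a::{finite,field} alg_closure"
  shows "x \<in> range to_ac \<longleftrightarrow> x ^ CARD('a) = x"
proof -
  let ?p = "monom 1 CARD('a) - [:0, 1:] :: 'a alg_closure poly"
  let ?R = "{y. poly ?p y = 0}"
  have "card {0 :: 'a, 1} \<le> CARD('a)"
    by (intro card_mono) auto
  hence gt: "CARD('a) > 1"
    by simp
  have "coeff ?p CARD('a) = 1"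
    using gt by (simp add: coeff_pCons split: nat.splits)
  hence nz: "?p \<noteq> 0" by (metis coeff_0 zero_neq_one)
  have deg: "degree ?p \<le> CARD('a)"
    using gt by (intro degree_diff_le) (auto simp: degree_monom_le)
  have R: "y \<in> ?R \<longleftrightarrow> y ^ CARD('a) = y" for y
    by (simp add: poly_monom)
  have "range to_ac \<subseteq> ?R"
    using power_CARD_eq_self by (auto simp: poly_monom simp flip: to_ac_power)
  moreover have "card ?R \<le> card (range (to_ac :: 'a \<Rightarrow> _))"
    using card_poly_roots_bound[OF nz] deg by (simp add: card_image inj_to_ac)
  ultimately have "range to_ac = ?R"
    using poly_roots_finite[OF nz] by (intro card_seteq) auto
  thus ?thesis using R by blast
qed

definition frob :: "nat \<Rightarrow> 'a::{finite,field} alg_closure \<Rightarrow> 'a alg_closure" where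
  "frob k x = x ^ (CARD('a) ^ k)"

lemma frob_0_left [simp]: "frob 0 x = x"
  by (simp add: frob_def)

lemma frob_add_left: "frob (i + j) x = frob i (frob j x)"
  by (simp add: frob_def power_add mult.commute flip: power_mult)

lemma frob_mult: "frob k (x * y) = frob k x * frob k y"
  by (simp add: frob_def power_mult_distrib)

lemma frob_power: "frob k (x ^ n) = frob k x ^ n"
  by (simp add: frob_def mult.commute flip: power_mult)

lemma frob_divide: "frob k (x / y) = frob k x / frob k y"
  by (simp add: frob_def power_divide)

lemma frob_0 [simp]: "frob k 0 = 0"
  by (simp add: frob_def power_0_left)

lemma frob_eq_0_iff [simp]: "frob k x = 0 \<longleftrightarrow> x = 0"
  by (simp add: frob_def)

lemma frob_to_ac [simp]: "frob k (to_ac x) = to_ac x"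
proof (induction k)
  case (Suc k)
  have "frob 1 (to_ac x) = to_ac x"
    using power_CARD_eq_self[of x] by (simp add: frob_def flip: to_ac_power)
  thus ?case using Suc by (metis frob_add_left Suc_eq_plus1)
qed simp

lemma frob_1_eq_iff: "frob 1 x = x \<longleftrightarrow> x \<in> range to_ac"
  by (simp add: to_ac_range_iff frob_def)

text \<open>The exact size of the Frobenius orbit: divisibility encodes both that \<open>n\<close>
  is a period and that no smaller positive one exists.\<close>

definition frob_period :: "'a::{finite,field} alg_closure \<Rightarrow> nat \<Rightarrow> bool" where
  "frob_period x n \<longleftrightarrow> n > 0 \<and> (\<forall>j. frob j x = x \<longleftrightarrow> n dvd j)"

text \<open>The characteristic is a prime dividing a prime power, hence its base. This is what makes
  \<open>frob\<close> additive.\<close>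

lemma CARD_eq_CHAR_power:
  assumes "primepow CARD('a::{finite,field})"
  obtains k where "CARD('a) = CHAR('a) ^ k"
proof -
  obtain p k where p: "prime p" "CARD('a) = p ^ k"
    using assms by (auto simp: primepow_def)
  have "prime CHAR('a)"
    by (rule prime_CHAR_semidom) (rule finite_imp_CHAR_pos, simp)
  moreover have "CHAR('a) dvd p ^ k"
    using CHAR_dvd_CARD[where 'a = 'a] p by simp
  ultimately have "CHAR('a) = p"
    using p by (metis prime_dvd_power primes_dvd_imp_eq)
  thus ?thesis using p that by blast
qed

lemma frob_fixed_multiple: "frob n x = x \<Longrightarrow> frob (n * k) x = x"
  by (induction k) (simp_all add: frob_add_left)

section \<open>Roots, norms and r-th powers\<close>

lemma eval_ac_root_exists:
  assumes "degree p > 0"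
  obtains x where "eval_ac p x = 0"
  using alg_closed_imp_poly_has_root[of "map_poly to_ac p"] assms
  by (auto simp: degree_map_poly_to_ac)

lemma card_eval_ac_roots:
  assumes "p \<noteq> 0" "\<And>x. x \<in> A \<Longrightarrow> eval_ac p x = 0"
  shows "finite A" "card A \<le> degree p"
proof -
  let ?R = "{x. eval_ac p x = 0}"
  have nz: "map_poly to_ac p \<noteq> 0"
    using assms by (simp add: map_poly_to_ac_eq_0_iff)
  have sub: "A \<subseteq> ?R" using assms by auto
  have fin: "finite ?R" using nz by (rule poly_roots_finite)
  show "finite A" using sub fin by (rule finite_subset)
  have "card A \<le> card ?R" using fin sub by (rule card_mono)
  also have "\<dots> \<le> degree p"
    using card_poly_roots_bound[OF nz] by (simp add: degree_map_poly_to_ac)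
  finally show "card A \<le> degree p" .
qed

text \<open>The geometric series, used to express \<open>frob m t\<close> as \<open>t\<close> times
  a power of a norm.\<close>

lemma CARD_power_eq_geometric_sum:
  "CARD('a::finite) ^ m = Suc ((CARD('a) - 1) * (\<Sum>i<m. CARD('a) ^ i))"
proof -
  have geometric: "Suc (d * (\<Sum>i<m. Suc d ^ i)) = Suc d ^ m" for d
    by (induction m) (simp_all add: distrib_left)
  have "CARD('a) = Suc (CARD('a) - 1)"
    by (metis Suc_diff_1 zero_less_card_finite)
  thus ?thesis by (metis geometric)
qed

lemma prod_frob_eq_power: "(\<Prod>i<m. frob i x) = x ^ (\<Sum>i<m. CARD('a) ^ i)"
  for x :: "'a::{finite,field} alg_closure"
  by (simp add: frob_def power_sum)

text \<open>The order of \<open>z\<close> divides the prime \<open>r\<close> and is not 1.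
  Concretely, if \<open>r\<close> does not divide \<open>k\<close>, an inverse of \<open>k\<close>
  modulo \<open>r\<close> recovers \<open>z\<close> as a power of \<open>z ^ k\<close>.\<close>

lemma prime_root_of_unity_power_eq_1_iff:
  fixes z :: "'a::field"
  assumes "prime r" "z ^ r = 1" "z \<noteq> 1"
  shows "z ^ k = 1 \<longleftrightarrow> r dvd k"
proof
  assume zk: "z ^ k = 1"
  show "r dvd k"
  proof (rule ccontr)
    assume "\<not> r dvd k"
    hence "coprime k r"
      using prime_imp_coprime[OF assms(1)] by (simp add: coprime_commute)
    then obtain x where "[k * x = 1] (mod r)"
      using cong_solve_coprime_nat[of k r] by auto
    moreover have "r > 1" using assms(1) by (rule prime_gt_1_nat)
    ultimately have "k * x = r * (k * x div r) + 1"
      by (metis cong_def mod_less mult_div_mod_eq)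
    hence "z ^ (k * x) = z ^ (r * (k * x div r)) * z"
      by (metis Suc_eq_plus1 power_Suc2)
    hence "z = 1"
      using zk assms(2) by (simp add: power_mult)
    with assms(3) show False by simp
  qed
qed (use assms(2) in \<open>auto simp: power_mult\<close>)

text \<open>Euler's criterion with s = (q - 1) / r. For the converse, a root \<open>z\<close> of
  \<open>z ^ r = to_ac x\<close> has q-th power z x^s, so \<open>x ^ s = 1\<close> puts
  \<open>z\<close> in the base field.\<close>

lemma is_nth_power_iff_power_eq_1:
  fixes x :: "'a::{finite,field}"
  assumes "CARD('a) = Suc (r * s)" "r > 0" "x \<noteq> 0"
  shows "is_nth_power r x \<longleftrightarrow> x ^ s = 1"
proof
  assume "is_nth_power r x"
  then obtain y where y: "x = y ^ r" by (rule is_nth_powerE)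
  have "y * y ^ (r * s) = y * 1"
    using power_CARD_eq_self[of y] assms(1) by simp
  thus "x ^ s = 1"
    using y assms(2,3) by (auto simp: power_mult power_0_left)
next
  assume xs: "x ^ s = 1"
  obtain z where z: "z ^ r = to_ac x"
    using nth_root_exists[OF assms(2)] by blast
  have "z ^ CARD('a) = z * (z ^ r) ^ s"
    by (simp add: assms(1) power_mult)
  also have "\<dots> = z"
    by (simp add: z xs flip: to_ac_power)
  finally obtain y where "z = to_ac y"
    unfolding to_ac_range_iff[symmetric] by blast
  hence "x = y ^ r"
    using z by (simp flip: to_ac_power)
  thus "is_nth_power r x" ..
qed

text \<open>A Kummer-type step: for nonzero \<open>t\<close> the period of \<open>t\<close> is
  \<open>m\<close> times the order of \<open>N ^ s\<close>, and this order is 1 or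
  \<open>r\<close>.\<close>

lemma frob_period_radical:
  fixes t :: "'a::{finite,field} alg_closure"
  assumes r: "prime r" and card: "CARD('a) = Suc (r * s)"
    and per: "frob_period (t ^ r) m"
    and N: "to_ac N = (\<Prod>i<m. frob i (t ^ r))"
  shows "frob_period t (m * r) \<longleftrightarrow> \<not> is_nth_power r N"
proof (cases "t = 0")
  \<comment> \<open>Both sides fail: the norm 0 is an \<open>r\<close>-th power, and
    \<open>t\<close> has period 1, which is not a multiple of \<open>r\<close>.\<close>
  case True
  have "m > 0" using per by (simp add: frob_period_def)
  hence "to_ac N = 0"
    using r True by (auto simp: N prime_gt_0_nat)
  hence "is_nth_power r N"
    using r by (simp add: prime_gt_0_nat)
  have "\<not> m * r dvd 1"
    using r by auto
  moreover have "frob 1 t = t"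
    using True by simp
  ultimately have "\<not> frob_period t (m * r)"
    by (metis frob_period_def)
  thus ?thesis using \<open>is_nth_power r N\<close> by blast
next
  case False
  define z where "z = N ^ s"
  have m: "m > 0" using per by (simp add: frob_period_def)
  have r1: "r > 1" using r by (rule prime_gt_1_nat)
  have N0: "N \<noteq> 0"
    using False N by (metis prod_frob_eq_power power_not_zero to_ac_0)
  \<comment> \<open>The exponent q^m equals 1 + r s S with S the geometric sum, and raising
    \<open>t ^ r\<close> to S gives the norm.\<close>
  have frob_m: "frob m t = to_ac z * t"
  proof -
    let ?S = "\<Sum>i<m. CARD('a) ^ i"
    have "frob m t = t * t ^ (r * s * ?S)"
      unfolding frob_def by (subst CARD_power_eq_geometric_sum) (simp add: card)
    also have "t ^ (r * s * ?S) = ((t ^ r) ^ ?S) ^ s"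
      by (simp add: mult_ac flip: power_mult)
    also have "\<dots> = to_ac z"
      by (simp add: z_def N prod_frob_eq_power)
    finally show ?thesis by simp
  qed
  \<comment> \<open>Frobenius fixes \<open>to_ac z\<close>, so each further application of
    \<open>frob m\<close> contributes one more factor.\<close>
  have frob_mk: "frob (m * k) t = to_ac (z ^ k) * t" for k
  proof (induction k)
    case (Suc k)
    have "frob (m * Suc k) t = frob (m * k) (frob m t)"
      by (simp add: add.commute flip: frob_add_left)
    thus ?case
      by (simp add: frob_m frob_mult Suc.IH)
  qed simp
  \<comment> \<open>A period of \<open>t\<close> is also a period of \<open>t ^ r\<close>, hence a
    multiple of \<open>m\<close>.\<close>
  have frob_t: "frob j t = t \<longleftrightarrow> m dvd j \<and> z ^ (j div m) = 1" for j
  proof (cases "m dvd j")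
    case True
    then obtain k where "j = m * k" by (rule dvdE)
    moreover have "to_ac (z ^ k) * t = t \<longleftrightarrow> to_ac (z ^ k) = to_ac 1"
      using False mult_cancel_right[of "to_ac (z ^ k)" t 1] by simp
    ultimately show ?thesis
      using m by (simp only: frob_mk to_ac_eq_iff) simp
  next
    case nd: False
    hence "frob j (t ^ r) \<noteq> t ^ r"
      using per by (simp add: frob_period_def)
    thus ?thesis using nd by (auto simp: frob_power)
  qed
  have "z ^ r = 1"
  proof -
    have "N * N ^ (r * s) = N * 1"
      using power_CARD_eq_self[of N] card by simp
    thus ?thesis using N0 by (simp add: z_def mult.commute flip: power_mult)
  qed
  have "frob_period t (m * r) \<longleftrightarrow> z \<noteq> 1"
  proof
    assume per': "frob_period t (m * r)"
    show "z \<noteq> 1"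
    proof
      assume "z = 1"
      hence "frob m t = t" by (simp add: frob_m)
      hence "m * r dvd m * 1" using per' by (simp add: frob_period_def)
      thus False using m r1 by (simp only: nat_mult_dvd_cancel_disj) simp
    qed
  next
    assume "z \<noteq> 1"
    hence "z ^ k = 1 \<longleftrightarrow> r dvd k" for k
      by (rule prime_root_of_unity_power_eq_1_iff[OF r \<open>z ^ r = 1\<close>])
    moreover have "m dvd j \<and> r dvd j div m \<longleftrightarrow> m * r dvd j" for j
      using m by (metis dvd_div_iff_mult dvd_mult_left mult.commute neq0_conv)
    ultimately have "frob j t = t \<longleftrightarrow> m * r dvd j" for j
      by (simp only: frob_t)
    thus "frob_period t (m * r)"
      using m r1 by (simp add: frob_period_def)
  qed
  also have "\<dots> \<longleftrightarrow> \<not> is_nth_power r N"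
    using is_nth_power_iff_power_eq_1[OF card _ N0] r1 by (simp add: z_def)
  finally show ?thesis .
qed

section \<open>Frobenius orbits and irreducibility over the base field\<close>

context
  assumes primepow_CARD: "primepow CARD('a::{finite,field})"
begin

lemma frob_add: "frob k (x + y :: 'a alg_closure) = frob k x + frob k y"
proof -
  obtain l where l: "CARD('a) = CHAR('a) ^ l"
    using CARD_eq_CHAR_power primepow_CARD by blast
  have "prime CHAR('a)"
    by (rule prime_CHAR_semidom) (rule finite_imp_CHAR_pos, simp)
  thus ?thesis
    unfolding frob_def by (intro freshmans_dream'[where n = "l * k"]) (simp_all add: l power_mult)
qed

lemma frob_diff: "frob k (x - y :: 'a alg_closure) = frob k x - frob k y"
  using frob_add[of k "x - y" y] by simp

lemma frob_eq_iff: "frob k (x :: 'a alg_closure) = frob k y \<longleftrightarrow> x = y"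
  using frob_diff[of k x y] frob_eq_0_iff[of k "x - y"] by auto

text \<open>Frobenius fixes the coefficients. Hence it maps roots of a polynomial over the base
  field to roots.\<close>

lemma frob_eval_ac: "frob k (eval_ac p x) = eval_ac p (frob k x :: 'a alg_closure)"
proof -
  have "map_poly (frob k) (map_poly to_ac p) = map_poly to_ac p"
    by (simp add: map_poly_map_poly o_def)
  thus ?thesis
    by (metis poly_map_poly_hom[of "frob k"] frob_0 frob_add frob_mult)
qed

lemma frob_period_inj:
  assumes "frob_period (x :: 'a alg_closure) n"
  shows "inj_on (\<lambda>i. frob i x) {..<n}"
proof (rule linorder_inj_onI')
  fix i j assume ij: "i \<in> {..<n}" "j \<in> {..<n}" "i < j"
  show "frob i x \<noteq> frob j x"
  proof
    assume "frob i x = frob j x"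
    also have "frob j x = frob i (frob (j - i) x)"
      using ij by (simp flip: frob_add_left)
    finally have "frob (j - i) x = x"
      by (metis frob_eq_iff)
    hence "n dvd j - i"
      using assms by (simp add: frob_period_def)
    thus False using ij by (auto dest: dvd_imp_le)
  qed
qed

text \<open>The orbit lies in the finite root set of a polynomial, so two conjugates coincide and
  injectivity yields a positive period. The least one divides all others by division with
  remainder.\<close>

lemma frob_period_exists:
  fixes x :: "'a alg_closure"
  obtains n where "frob_period x n"
proof -
  obtain p where p: "p \<noteq> 0" "eval_ac p x = 0"
    by (rule alg_closure_algebraic)
  have "finite (range (\<lambda>i. frob i x))"
    by (rule card_eval_ac_roots(1)[OF p(1)])
       (use p in \<open>auto simp flip: frob_eval_ac\<close>)
  hence "\<not> inj (\<lambda>i. frob i x)"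
    using finite_imageD infinite_UNIV_nat by blast
  then obtain i j where "i < j" "frob i x = frob j x"
    using linorder_inj_onI'[of UNIV "\<lambda>i. frob i x"] by blast
  hence "frob i (frob (j - i) x) = frob i x"
    by (simp flip: frob_add_left)
  hence ex: "j - i > 0 \<and> frob (j - i) x = x"
    using \<open>i < j\<close> by (simp only: frob_eq_iff zero_less_diff simp_thms)
  define n where "n = (LEAST n. n > 0 \<and> frob n x = x)"
  have n: "n > 0 \<and> frob n x = x"
    unfolding n_def by (rule LeastI[of _ "j - i"]) (use ex in auto)
  have least: "n \<le> k" if "k > 0" "frob k x = x" for k
    unfolding n_def by (rule Least_le) (use that in auto)
  have "n dvd k" if "frob k x = x" for k
  proof -
    have "frob k x = frob (k mod n) (frob (n * (k div n)) x)"
      by (simp flip: frob_add_left)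
    also have "frob (n * (k div n)) x = x"
      using n by (intro frob_fixed_multiple) simp
    finally have "frob (k mod n) x = x" using that by simp
    hence "k mod n = 0"
      using least[of "k mod n"] n by (metis gr0I leD mod_less_divisor)
    thus ?thesis by auto
  qed
  moreover have "frob k x = x" if "n dvd k" for k
    using that n frob_fixed_multiple by (metis dvdE)
  ultimately have "frob_period x n"
    using n unfolding frob_period_def by blast
  thus thesis by (rule that)
qed

text \<open>Frobenius shifts the orbit, with index \<open>n - 1\<close> returning to 0. An injective
  self-map of a finite set is onto.\<close>

lemma frob_orbit_image:
  assumes "frob_period (x :: 'a alg_closure) n"
  shows "frob 1 ` (\<lambda>i. frob i x) ` {..<n} = (\<lambda>i. frob i x) ` {..<n}"
proof (rule endo_inj_surj)
  show "frob 1 ` (\<lambda>i. frob i x) ` {..<n} \<subseteq> (\<lambda>i. frob i x) ` {..<n}"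
  proof clarify
    fix i assume "i < n"
    show "frob 1 (frob i x) \<in> (\<lambda>i. frob i x) ` {..<n}"
    proof (cases "Suc i = n")
      case True
      have "frob 1 (frob i x) = frob n x"
        by (simp add: True flip: frob_add_left)
      also have "\<dots> = frob 0 x"
        using assms by (simp add: frob_period_def)
      finally show ?thesis using \<open>i < n\<close> by (intro image_eqI[of _ _ 0]) auto
    next
      case False
      thus ?thesis using \<open>i < n\<close>
        by (intro image_eqI[of _ _ "Suc i"]) (simp_all flip: frob_add_left)
    qed
  qed
  show "inj_on (frob 1) ((\<lambda>i. frob i x) ` {..<n})"
    by (auto intro!: inj_onI simp: frob_eq_iff)
qed simp

text \<open>The product of the linear factors over all conjugates; it bounds the degree of the
  minimal polynomial from above.\<close>

lemma frob_period_poly: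
  assumes per: "frob_period (x :: 'a alg_closure) n"
  obtains p where "p \<noteq> 0" "degree p = n" "eval_ac p x = 0"
proof -
  let ?A = "(\<lambda>i. frob i x) ` {..<n}"
  have n: "n > 0" using per by (simp add: frob_period_def)
  have card_A: "card ?A = n"
    using frob_period_inj[OF per] by (simp add: card_image)
  \<comment> \<open>\<open>P\<close> has coefficients in the base field, as Frobenius permutes its roots and so fixes it.\<close>
  define P where "P = (\<Prod>y\<in>?A. [:-y, 1:])"
  define P' where "P' = map_poly (frob 1) P"
  have deg: "degree P = n"
    unfolding P_def by (subst degree_prod_eq_sum_degree) (simp_all add: card_A)
  have lead: "lead_coeff P = 1"
    unfolding P_def by (simp add: lead_coeff_prod)
  have root: "poly P y = 0" if "y \<in> ?A" for y
    using that by (auto simp: P_def poly_prod)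
  have deg': "degree P' = n"
    unfolding P'_def by (subst degree_map_poly) (simp_all add: deg)
  have root': "poly P' y = 0" if "y \<in> ?A" for y
  proof -
    have "y \<in> frob 1 ` ?A"
      using that by (subst frob_orbit_image[OF per])
    then obtain z where z: "z \<in> ?A" "y = frob 1 z"
      by (rule imageE)
    have "poly P' (frob 1 z) = frob 1 (poly P z)"
      unfolding P'_def
      by (rule poly_map_poly_hom) (simp_all add: frob_add frob_mult)
    thus ?thesis using z root by simp
  qed
  \<comment> \<open>Two polynomials of degree \<open>n\<close> with equal leading coefficients that
    agree at \<open>n\<close> points coincide.\<close>
  have "P' = P"
  proof (rule poly_eqI_degree_lead_coeff[where A = ?A and n = n])
    show "coeff P' n = coeff P n"
      using lead deg by (simp add: P'_def coeff_map_poly frob_def)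
  qed (simp_all add: deg deg' card_A root root')
  hence "coeff P' i = coeff P i" for i by simp
  hence "frob 1 (coeff P i) = coeff P i" for i
    unfolding P'_def by (subst (asm) coeff_map_poly) simp_all
  hence coeffs: "coeff P i \<in> range to_ac" for i
    by (simp only: frob_1_eq_iff)
  define p where "p = map_poly of_ac P"
  have p: "P = map_poly to_ac p"
    by (intro poly_eqI) (simp add: p_def coeff_map_poly to_ac_of_ac[OF coeffs])
  have deg_p: "degree p = n"
    using deg by (simp add: p degree_map_poly_to_ac)
  have "x \<in> ?A"
    using n by (intro image_eqI[of _ _ 0]) auto
  hence "eval_ac p x = 0"
    using root by (simp add: p)
  thus thesis
    using that[of p] deg_p n by force
qed

text \<open>All conjugates of \<open>x\<close> are roots of any polynomial over the base field
  vanishing at \<open>x\<close>, so its degree, if it is nonzero, is at least the period. An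
  irreducible \<open>h\<close> is the minimal polynomial up to a unit, whose degree is at most the
  period. Conversely, a factor of \<open>h\<close> vanishing at \<open>x\<close> has full degree, so
  its cofactor is constant.\<close>

lemma irreducible_iff_frob_period:
  fixes h :: "'a poly"
  assumes deg: "degree h > 0" and root: "eval_ac h x = 0"
  shows "irreducible h \<longleftrightarrow> frob_period x (degree h)"
proof
  have orbit: "n \<le> degree p" if "p \<noteq> 0" "eval_ac p x = 0" "frob_period x n" for p n
  proof -
    have "card ((\<lambda>i. frob i x) ` {..<n}) \<le> degree p"
      by (rule card_eval_ac_roots(2)[OF that(1)])
         (use that in \<open>auto simp flip: frob_eval_ac\<close>)
    thus ?thesis
      using frob_period_inj[OF that(3)] by (simp add: card_image)
  qed
  have nz: "h \<noteq> 0" using deg by auto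
  show "frob_period x (degree h)" if irr: "irreducible h"
  proof -
    obtain n where n: "frob_period x n" by (rule frob_period_exists)
    obtain p where p: "p \<noteq> 0" "degree p = n" "eval_ac p x = 0"
      using frob_period_poly[OF n] by blast
    \<comment> \<open>\<open>u\<close> is the minimal polynomial of \<open>x\<close> up to a unit.\<close>
    obtain u where u: "u \<noteq> 0 \<and> eval_ac u x = 0"
      and least: "\<And>v. v \<noteq> 0 \<and> eval_ac v x = 0 \<Longrightarrow> degree u \<le> degree v"
      using ex_has_least_nat[of "\<lambda>u. u \<noteq> 0 \<and> eval_ac u x = 0" p degree] p by blast
    \<comment> \<open>The remainder vanishes at \<open>x\<close>, so minimality of \<open>u\<close>
      forces it to be zero.\<close>
    have "eval_ac (h div u * u + h mod u) x = 0"
      using root by simp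
    hence "eval_ac (h mod u) x = 0"
      using u by (simp only: eval_ac_add eval_ac_mult) simp
    hence "h mod u = 0"
      using least[of "h mod u"] u degree_mod_less'[of u h] by force
    hence h: "h = u * (h div u)"
      by (simp add: mult.commute minus_mod_eq_mult_div [symmetric])
    have "degree u > 0"
      using u by (auto simp: map_poly_pCons elim!: degree_eq_zeroE intro!: Nat.gr0I)
    hence "\<not> u dvd 1"
      using is_unit_iff_degree[of u] u by simp
    hence "h div u dvd 1"
      using irr h irreducibleD by blast
    hence "degree (h div u) = 0" using is_unit_iff_degree[of "h div u"] h nz by force
    hence "degree h \<le> degree u"
      using h by (metis add.right_neutral degree_mult_le)
    hence "degree h \<le> n" using least[of p] p by simp
    moreover have "n \<le> degree h" using orbit[OF nz root n] .
    ultimately show ?thesis using n by simp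
  qed
  show "irreducible h" if per: "frob_period x (degree h)"
  proof (rule irreducibleI)
    show "\<not> h dvd 1" using deg nz is_unit_iff_degree[of h] by simp
    fix u v assume uv: "h = u * v"
    hence nz': "u \<noteq> 0" "v \<noteq> 0" using nz by auto
    have "eval_ac u x = 0 \<or> eval_ac v x = 0"
      using root by (simp add: uv eval_ac_mult)
    hence "degree h \<le> degree u \<or> degree h \<le> degree v"
      using orbit per nz' by blast
    hence "degree u = 0 \<or> degree v = 0"
      using nz' by (auto simp: uv degree_mult_eq)
    thus "u dvd 1 \<or> v dvd 1"
      using nz' is_unit_iff_degree by blast
  qed (use nz in auto)
qed

section \<open>Norms and composition with a unicritical polynomial\<close>

lemma poly_conv_prod_frob:
  fixes g :: "'a poly"
  assumes root: "eval_ac g x = 0" and per: "frob_period x (degree g)"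
  shows "map_poly to_ac g =
    smult (to_ac (lead_coeff g)) (\<Prod>i<degree g. [:- frob i x, 1:])" (is "_ = ?P")
\<comment> \<open>The leading coefficients agree, and both sides vanish at the
  \<open>degree g\<close> distinct conjugates of \<open>x\<close>.\<close>
proof (rule poly_eqI_degree_lead_coeff)
  let ?A = "(\<lambda>i. frob i x) ` {..<degree g}"
  have deg: "degree (\<Prod>i<degree g. [:- frob i x, 1:]) = degree g"
    by (subst degree_prod_eq_sum_degree) simp_all
  have "lead_coeff (\<Prod>i<degree g. [:- frob i x, 1:]) = 1"
    by (simp add: lead_coeff_prod)
  thus "coeff (map_poly to_ac g) (degree g) = coeff ?P (degree g)"
    by (simp add: coeff_map_poly deg)
  show "degree g \<le> card ?A"
    using frob_period_inj[OF per] by (simp add: card_image)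
  show "degree (map_poly to_ac g) \<le> degree g" "degree ?P \<le> degree g"
    by (simp_all add: degree_map_poly_to_ac deg)
  fix y assume "y \<in> ?A"
  then obtain i where i: "i < degree g" "y = frob i x" by auto
  have "eval_ac g y = 0"
    using root by (simp add: i flip: frob_eval_ac)
  moreover have "poly ?P y = 0"
    using i by (auto simp: poly_prod)
  ultimately show "eval_ac g y = poly ?P y" by simp
qed

text \<open>Evaluate the factorization of \<open>g\<close> at \<open>e\<close>. Each conjugate
  contributes a further factor \<open>-1 / a\<close>, whence the sign and the power of
  \<open>a\<close>.\<close>

lemma prod_frob_affine:
  fixes g :: "'a poly"
  assumes "eval_ac g x = 0" "frob_period x (degree g)" "g \<noteq> 0"
  shows "(\<Prod>i<degree g. frob i ((x - to_ac e) / to_ac a)) =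
    to_ac ((-1) ^ degree g * poly g e / (lead_coeff g * a ^ degree g))"
proof -
  let ?m = "degree g"
  have "to_ac (poly g e) = to_ac (lead_coeff g) * (\<Prod>i<?m. to_ac e - frob i x)"
    using poly_conv_prod_frob[OF assms(1,2)] by (simp add: poly_prod flip: eval_ac_to_ac)
  hence *: "(\<Prod>i<?m. to_ac e - frob i x) = to_ac (poly g e / lead_coeff g)"
    using assms(3) by (simp add: field_simps)
  have "frob i ((x - to_ac e) / to_ac a) = to_ac (-1 / a) * (to_ac e - frob i x)" for i
    by (simp add: frob_divide frob_diff diff_divide_distrib left_diff_distrib)
  hence "(\<Prod>i<?m. frob i ((x - to_ac e) / to_ac a)) =
      to_ac ((-1 / a) ^ ?m) * (\<Prod>i<?m. to_ac e - frob i x)"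
    by (simp only: prod.distrib prod_constant card_lessThan to_ac_power)
  also have "\<dots> = to_ac ((-1 / a) ^ ?m * (poly g e / lead_coeff g))"
    unfolding * by (rule to_ac_mult [symmetric])
  also have "(-1 / a) ^ ?m * (poly g e / lead_coeff g) =
      (-1) ^ ?m * poly g e / (lead_coeff g * a ^ ?m)"
    by (simp only: power_divide times_divide_times_eq mult.commute[of _ "a ^ ?m"])
  finally show ?thesis .
qed

text \<open>Frobenius commutes with affine bijections over the base field.\<close>

lemma frob_period_affine:
  assumes "a \<noteq> 0"
  shows "frob_period ((x - to_ac b) / to_ac a :: 'a alg_closure) n \<longleftrightarrow> frob_period x n"
  using assms by (simp add: frob_period_def frob_divide frob_diff)

text \<open>A form of Capelli's lemma over finite fields: irreducibility becomes the period of
  \<open>t + to_ac c\<close>, the shift by \<open>c\<close> is removed, and the norm of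
  \<open>t ^ r\<close> decides.\<close>

lemma irreducible_pcompose_unicritical_iff:
  fixes g :: "'a poly"
  assumes irr: "irreducible g" and deg: "degree g > 0"
    and r: "prime r" "[CARD('a) = 1] (mod r)" and a: "a \<noteq> 0"
    and f: "f = smult a ([:- c, 1:] ^ r) + [:e:]"
  shows "irreducible (g \<circ>\<^sub>p f) \<longleftrightarrow>
    \<not> is_nth_power r ((-1) ^ degree g * poly g e / (lead_coeff g * a ^ degree g))"
proof -
  obtain s where s: "CARD('a) = Suc (r * s)"
  proof -
    have "r dvd CARD('a) - 1"
      using r(2) zero_less_card_finite[where 'a = 'a]
      by (simp add: cong_altdef_nat Suc_le_eq)
    then obtain s where "CARD('a) - 1 = r * s" by (rule dvdE)
    hence "CARD('a) = Suc (r * s)"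
      by (metis Suc_diff_1 zero_less_card_finite)
    thus thesis by (rule that)
  qed
  have r0: "r > 0" using r by (simp add: prime_gt_0_nat)
  have deg_f: "degree f = r"
    using r0 a by (simp add: f degree_add_eq_left degree_power_eq)
  obtain b where b: "eval_ac g b = 0"
    using eval_ac_root_exists[OF deg] .
  obtain t where t: "t ^ r = (b - to_ac e) / to_ac a"
    using nth_root_exists[OF r0] by blast
  have "eval_ac f (t + to_ac c) = b"
    using a by (simp add: f t eval_ac_add eval_ac_smult eval_ac_power eval_ac_pCons)
  hence root: "eval_ac (g \<circ>\<^sub>p f) (t + to_ac c) = 0"
    using b by (simp add: eval_ac_pcompose)
  have per: "frob_period b (degree g)"
    using irreducible_iff_frob_period[OF deg b] irr by simp
  have "irreducible (g \<circ>\<^sub>p f) \<longleftrightarrow> frob_period (t + to_ac c) (degree g * r)"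
    using irreducible_iff_frob_period[OF _ root] deg r0 deg_f
    by (simp add: degree_pcompose)
  also have "\<dots> \<longleftrightarrow> frob_period t (degree g * r)"
    using frob_period_affine[of 1 "t + to_ac c" c "degree g * r"] by simp
  also have "\<dots> \<longleftrightarrow>
      \<not> is_nth_power r ((-1) ^ degree g * poly g e / (lead_coeff g * a ^ degree g))"
  proof (rule frob_period_radical[OF r(1) s])
    show "frob_period (t ^ r) (degree g)"
      using per a by (simp add: t frob_period_affine)
    show "to_ac ((-1) ^ degree g * poly g e / (lead_coeff g * a ^ degree g)) =
        (\<Prod>i<degree g. frob i (t ^ r))"
      unfolding t using deg by (subst prod_frob_affine[OF b per]) auto
  qed
  finally show ?thesis .
qed

end

section \<open>Iterates and the criterion\<close>

lemma poly_iterate_0 [simp]: "poly_iterate f 0 = [:0, 1:]"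
  by (simp add: poly_iterate_def)

lemma poly_iterate_Suc: "poly_iterate f (Suc n) = f \<circ>\<^sub>p poly_iterate f n"
  by (simp add: poly_iterate_def)

text \<open>The irreducibility step needs \<open>f\<close> as the inner polynomial, whereas the
  definition puts it outside.\<close>

lemma poly_iterate_Suc': "poly_iterate f (Suc n) = poly_iterate f n \<circ>\<^sub>p f"
proof (induction n)
  case (Suc n)
  thus ?case by (metis poly_iterate_Suc pcompose_assoc)
qed (simp add: poly_iterate_Suc pcompose_pCons)

lemma degree_poly_iterate: "degree (poly_iterate f n) = degree f ^ n"
  for f :: "'a::field poly"
  by (induction n) (simp_all add: poly_iterate_Suc degree_pcompose)

lemma is_nth_power_mult_power_iff:
  fixes x u :: "'a::field"
  assumes "u \<noteq> 0"
  shows "is_nth_power r (x * u ^ r) \<longleftrightarrow> is_nth_power r x"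
proof
  assume "is_nth_power r (x * u ^ r)"
  then obtain y where "x * u ^ r = y ^ r" by (rule is_nth_powerE)
  hence "x = (y / u) ^ r"
    using assms by (simp add: power_divide field_simps)
  thus "is_nth_power r x" ..
next
  assume "is_nth_power r x"
  then obtain y where "x = y ^ r" by (rule is_nth_powerE)
  hence "x * u ^ r = (y * u) ^ r" by (simp add: power_mult_distrib)
  thus "is_nth_power r (x * u ^ r)" ..
qed

theorem theorem1:
  fixes f :: "'a::{finite, field} poly" and \<gamma> a :: 'a and r q :: nat
  assumes "prime r"
    and "primepow q"
    and "CARD('a) = q"
    and "[q = 1] (mod r)"
    and "degree f = r"
    and "unicritical_at f \<gamma>"
    and "a = lead_coeff f"
  shows "dynamically_irreducible f \<longleftrightarrow>
    (\<forall>x \<in> {- (poly f \<gamma> / a)} \<union> {poly (poly_iterate f n) \<gamma> / a | n. n > 1}.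
       \<not> is_nth_power r x)"
proof -
  have deg: "degree f \<ge> 2" and r: "r > 1"
    using assms by (simp_all add: prime_gt_1_nat unicritical_at_def)
  obtain b e where b: "b \<noteq> 0" and f: "f = smult b ([:- \<gamma>, 1:] ^ r) + [:e:]"
    using assms(5,6) by (auto simp: unicritical_at_def)
  \<comment> \<open>As \<open>r > 1\<close>, the constant \<open>e\<close> leaves the top
    coefficient alone, so \<open>b\<close> is the leading coefficient.\<close>
  have "coeff ([:e:]) r = 0"
    using r by (simp add: coeff_pCons split: nat.splits)
  hence "coeff f r = b"
    by (simp add: f coeff_linear_power)
  hence ab: "b = a" using assms(5,7) by simp
  have a: "a \<noteq> 0" using b ab by simp
  have e: "poly f \<gamma> = e"
    using r by (simp add: f power_0_left)
  let ?F = "poly_iterate f"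
  \<comment> \<open>\<open>crit n\<close> governs the passage from \<open>?F n\<close> to
    \<open>?F (Suc n)\<close>, hence the shifted index.\<close>
  define crit where "crit n = (if n = 0 then - (poly f \<gamma> / a) else poly (?F (Suc n)) \<gamma> / a)" for n
  have degF: "degree (?F n) = r ^ n" for n
    using assms(5) by (simp add: degree_poly_iterate)
  have step: "irreducible (?F (Suc n)) \<longleftrightarrow> \<not> is_nth_power r (crit n)"
    if irr: "irreducible (?F n)" for n
  proof -
    let ?N = "(-1) ^ degree (?F n) * poly (?F n) e / (lead_coeff (?F n) * a ^ degree (?F n))"
    have "irreducible (?F (Suc n)) \<longleftrightarrow> \<not> is_nth_power r ?N"
      unfolding poly_iterate_Suc'
    proof (rule irreducible_pcompose_unicritical_iff[OF _ irr])
      show "primepow CARD('a)" "[CARD('a) = 1] (mod r)"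
        using assms(2-4) by simp_all
      show "f = smult a ([:- \<gamma>, 1:] ^ r) + [:e:]"
        using f by (simp only: ab)
      show "degree (?F n) > 0"
        using r by (simp add: degF)
    qed (fact assms(1) a)+
    also have "is_nth_power r ?N \<longleftrightarrow> is_nth_power r (crit n)"
    proof (cases n)
      \<comment> \<open>The identity has degree 1, so the sign survives and the norm is
        \<open>- e / a\<close>.\<close>
      case 0
      thus ?thesis by (simp add: crit_def e)
    next
      case (Suc k)
      \<comment> \<open>The degree \<open>r ^ n\<close> is \<open>r ^ k * r\<close>, so the sign and
        the power of \<open>a\<close> are \<open>r\<close>-th powers. The leading coefficient is one
        too, up to a single factor \<open>a\<close>; \<open>u\<close> collects their
        \<open>r\<close>-th roots.\<close>
      define u where "u = (-1) ^ (r ^ k) / (lead_coeff (?F k) * a ^ (r ^ k))"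
      have "?F k \<noteq> 0" using degF[of k] r by auto
      hence u: "u \<noteq> 0" using a by (simp add: u_def)
      have "lead_coeff (?F n) = a * lead_coeff (?F k) ^ r"
        unfolding Suc poly_iterate_Suc using degF[of k] r assms(5,7)
        by (subst lead_coeff_comp) simp_all
      \<comment> \<open>Since \<open>e\<close> is the critical value, evaluating there advances the
        critical orbit by one.\<close>
      moreover have "poly (?F n) e = poly (?F (Suc n)) \<gamma>"
        by (simp only: poly_iterate_Suc' poly_pcompose e)
      ultimately have "?N = crit n * u ^ r"
        by (simp add: degF crit_def u_def Suc power_divide power_mult_distrib mult.commute
            flip: power_mult)
      thus ?thesis using u by (simp add: is_nth_power_mult_power_iff)
    qed
    finally show ?thesis .
  qed
  have "irreducible (?F 0)"
    by (simp add: irreducible_linear_field_poly)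
  \<comment> \<open>Each step presupposes irreducibility of the preceding iterate, so the induction
    starts at the identity.\<close>
  have "irreducible (?F n)" if "\<forall>n. \<not> is_nth_power r (crit n)" for n
    by (induction n) (use \<open>irreducible (?F 0)\<close> step that in blast)+
  hence "(\<forall>n. irreducible (?F n)) \<longleftrightarrow> (\<forall>n. \<not> is_nth_power r (crit n))"
    using step by blast
  \<comment> \<open>The definition starts at the first iterate; the iterate 0 is linear and so
    irreducible.\<close>
  moreover have "dynamically_irreducible f \<longleftrightarrow> (\<forall>n. irreducible (?F n))"
    using deg \<open>irreducible (?F 0)\<close> unfolding dynamically_irreducible_def by (metis gr0I)
  moreover have "{- (poly f \<gamma> / a)} \<union> {poly (?F n) \<gamma> / a | n. n > 1} = range crit"
  proof (intro equalityI subsetI)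
    fix x assume "x \<in> {- (poly f \<gamma> / a)} \<union> {poly (?F n) \<gamma> / a | n. n > 1}"
    then consider "x = crit 0" | n where "n > 1" "x = poly (?F n) \<gamma> / a"
      by (auto simp: crit_def)
    thus "x \<in> range crit"
    proof cases
      case (2 n)
      hence "x = crit (n - 1)" by (simp add: crit_def)
      thus ?thesis by simp
    qed simp
  next
    fix x assume "x \<in> range crit"
    then obtain n where "x = crit n" by (rule rangeE)
    thus "x \<in> {- (poly f \<gamma> / a)} \<union> {poly (?F n) \<gamma> / a | n. n > 1}"
      by (cases "n = 0") (auto simp: crit_def intro!: exI[of _ "Suc n"])
  qed
  ultimately show ?thesis by simp
qed

end
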